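(* For every $\mathbf u\in\mathbb R^n$ there exists $\mathbf v\in\mathbb R^n$ such that $$\mathbf u=(I-\pi_D)\mathbf v+(I-\pi_f)\pi_D\mathbf u.$$ Moreover, the two components in this decomposition are $A$-orthogonal, i.e., $\big((I-\pi_D)\mathbf v\big)^TA\,(I-\pi_f)\pi_D\mathbf u=0$.
   Context: $A\in\mathbb R^{n\times n}$ is symmetric positive definite (SPD), and $D\in\mathbb R^{n\times n}$ is a diagonal SPD matrix with $\mathbf v^TA\mathbf v\le\mathbf v^TD\mathbf v$ for all $\mathbf v\in\mathbb R^n$. The index set $\{1,\dots,n\}$ is partitioned into nonoverlapping aggregates $\mathcal A_1,\dots,\mathcal A_{n_a}$. The prolongation $P\in\mathbb R^{n\times n_c}$, of full column rank with $1\le n_c<n$, is block diagonal with respect to this partition, with blocks $P_{\mathcal A_i}$ (rows indexed by $\mathcal A_i$). On each aggregate, let $D_{\mathcal A_i}=D|_{\mathcal A_i}$ and choose vectors that are orthonormal with respect to $D_{\mathcal A_i}$ and span the $D_{\mathcal A_i}$-orthogonal complement of $\operatorname{Range}(P_{\mathcal A_i})$. Extended by zero outside $\mathcal A_i$, these vectors (for all $i$) are the columns of $P_\perp\in\mathbb R^{n\times(n-n_c)}$. Thus $P_\perp^TDP=0$ and $P_\perp^TDP_\perp=I$. Define $\pi_D=P(P^TDP)^{-1}P^TD$, $A_f=P_\perp^TAP_\perp$ and $\pi_f=P_\perp A_f^{-1}P_\perp^TA$. *)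

theory Defs
  imports "HOL-Analysis.Analysis"
begin

definition spd :: "real^'n^'n \<Rightarrow> bool" where
  "spd M \<longleftrightarrow> transpose M = M \<and> (\<forall>v. v \<noteq> 0 \<longrightarrow> v \<bullet> (M *v v) > 0)"

definition diagonal_matrix :: "real^'n^'n \<Rightarrow> bool" where
  "diagonal_matrix M \<longleftrightarrow> (\<forall>i j. i \<noteq> j \<longrightarrow> M $ i $ j = 0)"

text \<open>Parts of a family are allowed to be empty here: the block of \<open>P\<close> or \<open>P\<^sub>\<bottom>\<close>
  on some aggregate may have no column.\<close>

definition splits_UNIV :: "nat \<Rightarrow> (nat \<Rightarrow> 'k set) \<Rightarrow> bool" where
  "splits_UNIV m S \<longleftrightarrow> disjoint_family_on S {1..m} \<and> (\<Union>i\<in>{1..m}. S i) = UNIV"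

definition aggregates :: "nat \<Rightarrow> (nat \<Rightarrow> 'n set) \<Rightarrow> bool" where
  "aggregates m Agg \<longleftrightarrow> splits_UNIV m Agg \<and> (\<forall>i\<in>{1..m}. Agg i \<noteq> {})"

text \<open>Vectors and blocks living on an aggregate are identified with their extensions by zero:
  \<open>vecs_on S\<close> stands for the space of real vectors indexed by \<open>S\<close>, and \<open>block M S T\<close> for the
  submatrix of \<open>M\<close> with rows \<open>S\<close> and columns \<open>T\<close>.\<close>

definition vecs_on :: "'n set \<Rightarrow> (real^'n) set" where
  "vecs_on S = {x. \<forall>k. k \<notin> S \<longrightarrow> x $ k = 0}"

definition block :: "real^'c^'n \<Rightarrow> 'n set \<Rightarrow> 'c set \<Rightarrow> real^'c^'n" where
  "block M S T = (\<chi> k l. if k \<in> S \<and> l \<in> T then M $ k $ l else 0)"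

definition block_diagonal ::
    "nat \<Rightarrow> (nat \<Rightarrow> 'n set) \<Rightarrow> (nat \<Rightarrow> 'c set) \<Rightarrow> real^'c^'n \<Rightarrow> bool" where
  "block_diagonal m R C M \<longleftrightarrow> splits_UNIV m C \<and>
     (\<forall>i\<in>{1..m}. \<forall>j\<in>{1..m}. i \<noteq> j \<longrightarrow> block M (R i) (C j) = 0)"

text \<open>\<open>Q i\<close> is the set of indices of those columns of \<open>Pp\<close> that come from aggregate \<open>i\<close>;
  \<open>block_diagonal\<close> says that these columns vanish outside \<open>Agg i\<close>.\<close>

definition aggregate_complement ::
    "nat \<Rightarrow> (nat \<Rightarrow> 'n set) \<Rightarrow> (nat \<Rightarrow> 'c set) \<Rightarrow> (nat \<Rightarrow> 'p set) \<Rightarrow>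
     real^'n^'n \<Rightarrow> real^'c^'n \<Rightarrow> real^'p^'n \<Rightarrow> bool" where
  "aggregate_complement m Agg C Q D P Pp \<longleftrightarrow> block_diagonal m Agg Q Pp \<and>
     (\<forall>i\<in>{1..m}.
        let D_i = block D (Agg i) (Agg i);
            P_i = block P (Agg i) (C i);
            p = (\<lambda>j. column j (block Pp (Agg i) (Q i)))
        in (\<forall>j\<in>Q i. \<forall>k\<in>Q i. p j \<bullet> (D_i *v p k) = (if j = k then 1 else 0)) \<and>
           span (p ` Q i) =
             {x \<in> vecs_on (Agg i). \<forall>y \<in> range ((*v) P_i). x \<bullet> (D_i *v y) = 0})"

definition pi_D :: "real^'n^'n \<Rightarrow> real^'c^'n \<Rightarrow> real^'n^'n" where
  "pi_D D P = P ** matrix_inv (transpose P ** D ** P) ** transpose P ** D"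

definition A_f :: "real^'n^'n \<Rightarrow> real^'p^'n \<Rightarrow> real^'p^'p" where
  "A_f A Pp = transpose Pp ** A ** Pp"

definition pi_f :: "real^'n^'n \<Rightarrow> real^'p^'n \<Rightarrow> real^'n^'n" where
  "pi_f A Pp = Pp ** matrix_inv (A_f A Pp) ** transpose Pp ** A"

end

theory Submission
  imports Defs
begin

text \<open>The matrix \<^const>\<open>pi_D\<close> is an instance of a general construction: for an SPD matrix \<open>M\<close>
  and an injective \<open>W\<close>, \<open>pi_D M W\<close> is the \<open>M\<close>-orthogonal projector onto the range of \<open>W\<close>, and
  \<^const>\<open>pi_f\<close> is the same construction with \<open>M = A\<close>, \<open>W = P\<^sub>\<bottom>\<close> (lemma \<open>pi_f_eq_pi_D\<close>).
  What links the two projectors is that the range of \<open>P\<^sub>\<bottom>\<close> is the whole \<open>D\<close>-orthogonal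
  complement of the range of \<open>P\<close>, that is, both the kernel of \<open>\<pi>\<^sub>D\<close> and the range of \<open>I - \<pi>\<^sub>D\<close>
  (lemma \<open>range_aggregate_complement\<close>).

  Write \<open>w = \<pi>\<^sub>D u\<close> and \<open>q = \<pi>\<^sub>f w\<close>. Then \<open>u = (u - w + q) + (w - q)\<close>, where \<open>w - q = (I - \<pi>\<^sub>f) \<pi>\<^sub>D u\<close>.
  Since \<open>q\<close> lies in the range of \<open>P\<^sub>\<bottom>\<close>, it is annihilated by \<open>\<pi>\<^sub>D\<close>, so \<open>v = u + q\<close> gives
  \<open>(I - \<pi>\<^sub>D) v = u - w + q\<close>. This vector is in the range of \<open>P\<^sub>\<bottom>\<close>, and \<open>w - q\<close> is the residual of
  the \<open>A\<close>-orthogonal projection onto that range; hence the two components are \<open>A\<close>-orthogonal.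

  The description of the range of \<open>P\<^sub>\<bottom>\<close> is assembled from the aggregates: as \<open>D\<close> is diagonal,
  a vector is \<open>D\<close>-orthogonal to the columns of \<open>P\<close> if and only if each of its restrictions to
  an aggregate is, and each restriction is then a combination of the columns of \<open>P\<^sub>\<bottom>\<close> that belong
  to this aggregate.\<close>

section \<open>Orthogonal projectors with respect to an SPD matrix\<close>

lemma spd_inner_commute:
  assumes "spd M"
  shows "x \<bullet> (M *v y) = y \<bullet> (M *v x)"
  using assms by (metis dot_lmul_matrix inner_commute spd_def transpose_matrix_vector)

lemma inner_matrix_mult_left: "(W *v z) \<bullet> x = z \<bullet> (transpose W *v x)"
  for W :: "real^'c^'n"
  by (metis dot_lmul_matrix inner_commute transpose_matrix_vector)

text \<open>\<open>z \<bullet> W\<^sup>T M W z\<close> is the squared \<open>M\<close>-norm of \<open>W z\<close>, so the Gram matrix has trivial kernel.\<close>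

lemma invertible_gram_matrix:
  fixes M :: "real^'n^'n" and W :: "real^'c^'n"
  assumes "spd M" and "inj ((*v) W)"
  shows "invertible (transpose W ** M ** W)"
proof -
  have "z = 0" if "(transpose W ** M ** W) *v z = 0" for z
  proof -
    have "(W *v z) \<bullet> (M *v (W *v z)) = z \<bullet> ((transpose W ** M ** W) *v z)"
      by (simp add: inner_matrix_mult_left matrix_vector_mul_assoc matrix_mul_assoc)
    then have "W *v z = 0"
      using that assms(1) by (auto simp: spd_def)
    then show "z = 0"
      using assms(2) by (metis injD matrix_vector_mult_0_right)
  qed
  then show ?thesis
    by (meson invertible_left_inverse matrix_left_invertible_ker)
qed

lemma pi_f_eq_pi_D: "pi_f A W = pi_D A W"
  by (simp add: pi_f_def pi_D_def A_f_def)

lemma projector_in_range: "pi_D M W *v x \<in> range ((*v) W)"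
  by (metis matrix_mul_assoc matrix_vector_mul_assoc pi_D_def rangeI)

text \<open>With an invertible Gram matrix, the coefficients of \<open>pi_D M W *v v\<close> solve the normal
  equations \<open>W\<^sup>T M W z = W\<^sup>T M v\<close>.\<close>

lemma projector_residual_orthogonal:
  fixes M :: "real^'n^'n" and W :: "real^'c^'n"
  assumes "spd M" and "inj ((*v) W)"
  shows "(W *v y) \<bullet> (M *v (v - pi_D M W *v v)) = 0"
proof -
  let ?G = "transpose W ** M ** W"
  have "?G ** matrix_inv ?G = mat 1"
    using invertible_gram_matrix[OF assms] unfolding invertible_def matrix_inv_def by (rule someI2_ex) blast
  then have "(transpose W ** M) ** pi_D M W = transpose W ** M"
    unfolding pi_D_def by (simp add: matrix_mul_assoc)
  then have "transpose W *v (M *v (v - pi_D M W *v v)) = 0"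
    by (simp add: matrix_vector_mult_diff_distrib matrix_vector_mul_assoc matrix_mul_assoc)
  then show ?thesis
    by (simp add: inner_matrix_mult_left)
qed

lemma projector_kernel:
  fixes M :: "real^'n^'n" and W :: "real^'c^'n"
  assumes "transpose M = M" and "\<And>y. x \<bullet> (M *v (W *v y)) = 0"
  shows "pi_D M W *v x = 0"
proof -
  have "y \<bullet> (transpose W *v (M *v x)) = 0" for y
    using assms(2)[of y]
    by (metis assms(1) inner_commute inner_matrix_mult_left)
  then have "transpose W *v (M *v x) = 0"
    by (metis inner_eq_zero_iff)
  then show ?thesis
    unfolding pi_D_def by (simp add: matrix_vector_mul_assoc[symmetric])
qed

lemma inj_if_orthonormal_columns:
  fixes D :: "real^'n^'n" and W :: "real^'p^'n"
  assumes "\<And>j k. column j W \<bullet> (D *v column k W) = (if j = k then 1 else 0)"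
  shows "inj ((*v) W)"
proof -
  have "x = y" if "W *v x = W *v y" for x y
  proof -
    have coordinate: "column j W \<bullet> (D *v (W *v z)) = z $ j" for j z
    proof -
      have "D *v (W *v z) = (\<Sum>k\<in>UNIV. z $ k *\<^sub>R (D *v column k W))"
        by (simp add: matrix_mult_sum[of W] matrix_vector_right_distrib
            linear_sum[OF matrix_vector_mul_linear] matrix_vector_mult_scaleR
            scalar_mult_eq_scaleR)
      then have "column j W \<bullet> (D *v (W *v z)) = (\<Sum>k\<in>UNIV. if j = k then z $ k else 0)"
        by (simp add: inner_sum_right assms if_distrib cong: if_cong)
      then show ?thesis by simp
    qed
    show "x = y"
      using that coordinate by (metis vec_eq_iff)
  qed
  then show ?thesis by (rule injI)
qed

section \<open>Blocks and supports\<close>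

lemma inner_block:
  assumes "x \<in> vecs_on S" and "y \<in> vecs_on T"
  shows "x \<bullet> (block M S T *v y) = x \<bullet> (M *v y)"
proof -
  have "x $ k * (block M S T *v y) $ k = x $ k * (M *v y) $ k" for k
  proof (cases "k \<in> S")
    case True
    then have "(block M S T *v y) $ k = (M *v y) $ k"
      using assms(2) by (auto simp: block_def matrix_vector_mult_def vecs_on_def intro!: sum.cong)
    then show ?thesis by simp
  next
    case False
    then show ?thesis using assms(1) by (simp add: vecs_on_def)
  qed
  then show ?thesis unfolding inner_vec_def inner_real_def by (simp only: sum.neutral_const)
qed

lemma diagonal_matrix_mult_nth:
  fixes D :: "real^'n^'n"
  assumes "diagonal_matrix D"
  shows "(D *v x) $ k = D $ k $ k * x $ k"
proof -
  have "(D *v x) $ k = (\<Sum>j\<in>UNIV. if j = k then D $ k $ k * x $ k else 0)"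
    unfolding matrix_vector_mult_def vec_lambda_beta using assms
    by (intro sum.cong) (auto simp: diagonal_matrix_def)
  then show ?thesis by simp
qed

lemma inner_diagonal_disjoint:
  fixes D :: "real^'n^'n"
  assumes "diagonal_matrix D" and "x \<in> vecs_on S" and "y \<in> vecs_on T" and "S \<inter> T = {}"
  shows "x \<bullet> (D *v y) = 0"
proof -
  have "x $ k * (D *v y) $ k = 0" for k
    using assms(2-4) diagonal_matrix_mult_nth[OF assms(1), of y k]
    by (cases "k \<in> S") (auto simp: vecs_on_def)
  then show ?thesis unfolding inner_vec_def inner_real_def by (simp only: sum.neutral_const)
qed

lemma splits_UNIV_cases:
  assumes "splits_UNIV m S"
  obtains i where "i \<in> {1..m}" and "k \<in> S i"
  using assms unfolding splits_UNIV_def by blast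

lemma splits_UNIV_disjoint:
  assumes "splits_UNIV m S" and "i \<in> {1..m}" and "j \<in> {1..m}" and "i \<noteq> j"
  shows "S i \<inter> S j = {}"
  using assms by (auto simp: splits_UNIV_def disjoint_family_on_def)

lemma block_diagonal_column:
  fixes M :: "real^'c^'n"
  assumes "block_diagonal m R C M" and "splits_UNIV m R" and "i \<in> {1..m}" and "l \<in> C i"
  shows "column l M \<in> vecs_on (R i)"
    and "column l (block M (R i) (C i)) = column l M"
proof -
  have zero: "M $ k $ l = 0" if "k \<notin> R i" for k
  proof -
    obtain j where j: "j \<in> {1..m}" "k \<in> R j"
      by (rule splits_UNIV_cases[OF assms(2)])
    with that have "block M (R j) (C i) = 0"
      using assms(1,3) unfolding block_diagonal_def by metis
    then have "block M (R j) (C i) $ k $ l = 0" by simp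
    then show ?thesis using j assms(4) by (simp add: block_def)
  qed
  then show "column l M \<in> vecs_on (R i)"
    by (simp add: vecs_on_def column_def)
  show "column l (block M (R i) (C i)) = column l M"
    using zero assms(4) by (auto simp: vec_eq_iff column_def block_def)
qed

lemma orthogonal_to_range_iff:
  fixes D :: "real^'n^'n" and W :: "real^'c^'n"
  shows "(\<forall>z. x \<bullet> (D *v (W *v z)) = 0) \<longleftrightarrow> (\<forall>l. x \<bullet> (D *v column l W) = 0)"
proof
  assume "\<forall>z. x \<bullet> (D *v (W *v z)) = 0"
  then show "\<forall>l. x \<bullet> (D *v column l W) = 0"
    by (metis matrix_vector_mult_basis)
next
  assume "\<forall>l. x \<bullet> (D *v column l W) = 0"
  then show "\<forall>z. x \<bullet> (D *v (W *v z)) = 0"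
    by (simp add: matrix_mult_sum[of W] linear_sum[OF matrix_vector_mul_linear]
        matrix_vector_mult_scaleR scalar_mult_eq_scaleR inner_sum_right)
qed

text \<open>The columns of the block on an aggregate are columns of \<open>P\<close> or zero, so orthogonality to
  the range of the block can be tested with the unrestricted \<open>D\<close> and on the columns of \<open>P\<close>.\<close>

lemma orthogonal_to_block_range_iff:
  fixes D :: "real^'n^'n" and P :: "real^'c^'n"
  assumes "block_diagonal m R C P" and "splits_UNIV m R" and "i \<in> {1..m}"
    and "x \<in> vecs_on (R i)"
  shows "(\<forall>y \<in> range ((*v) (block P (R i) (C i))). x \<bullet> (block D (R i) (R i) *v y) = 0) \<longleftrightarrow>
    (\<forall>l\<in>C i. x \<bullet> (D *v column l P) = 0)"
proof -
  let ?B = "block P (R i) (C i)"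
  have "x \<bullet> (block D (R i) (R i) *v column l ?B) = (if l \<in> C i then x \<bullet> (D *v column l P) else 0)"
    for l
  proof (cases "l \<in> C i")
    case True
    then show ?thesis
      using block_diagonal_column[OF assms(1-3) True] inner_block[OF assms(4)] by simp
  next
    case False
    then have "column l ?B = 0" by (simp add: vec_eq_iff column_def block_def)
    then show ?thesis using False by simp
  qed
  then show ?thesis
    using orthogonal_to_range_iff[of x "block D (R i) (R i)" ?B] by auto
qed

section \<open>The columns of the complement\<close>

text \<open>On one aggregate this is the assumed orthonormality of the local vectors; columns of
  different aggregates have disjoint supports, which a diagonal matrix preserves.\<close>

lemma aggregate_complement_orthonormal:
  fixes D :: "real^'n^'n" and P :: "real^'c^'n" and Pp :: "real^'p^'n"
  assumes "diagonal_matrix D" and "aggregates m Agg"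
    and "aggregate_complement m Agg C Q D P Pp"
  shows "column j Pp \<bullet> (D *v column k Pp) = (if j = k then 1 else 0)"
proof -
  have split_Agg: "splits_UNIV m Agg" using assms(2) by (simp add: aggregates_def)
  have bd: "block_diagonal m Agg Q Pp" using assms(3) by (simp add: aggregate_complement_def)
  then have split_Q: "splits_UNIV m Q" by (simp add: block_diagonal_def)
  obtain i where i: "i \<in> {1..m}" "j \<in> Q i" by (rule splits_UNIV_cases[OF split_Q])
  obtain i' where i': "i' \<in> {1..m}" "k \<in> Q i'" by (rule splits_UNIV_cases[OF split_Q])
  note col_j = block_diagonal_column[OF bd split_Agg i]
  note col_k = block_diagonal_column[OF bd split_Agg i']
  show ?thesis
  proof (cases "i = i'")
    case True
    have "column j (block Pp (Agg i) (Q i)) \<bullet>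
        (block D (Agg i) (Agg i) *v column k (block Pp (Agg i) (Q i))) = (if j = k then 1 else 0)"
      using assms(3) i i' True unfolding aggregate_complement_def Let_def by blast
    then show ?thesis
      using True col_j col_k inner_block by metis
  next
    case False
    then have "j \<noteq> k" using splits_UNIV_disjoint[OF split_Q i(1) i'(1)] i i' by auto
    then show ?thesis
      using inner_diagonal_disjoint[OF assms(1) col_j(1) col_k(1)]
        splits_UNIV_disjoint[OF split_Agg i(1) i'(1) False] by simp
  qed
qed

lemma aggregate_complement_span:
  fixes D :: "real^'n^'n" and P :: "real^'c^'n" and Pp :: "real^'p^'n"
  assumes "aggregates m Agg" and "block_diagonal m Agg C P"
    and "aggregate_complement m Agg C Q D P Pp" and "i \<in> {1..m}"
  shows "span ((\<lambda>j. column j Pp) ` Q i) =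
    {x \<in> vecs_on (Agg i). \<forall>l\<in>C i. x \<bullet> (D *v column l P) = 0}"
proof -
  have split_Agg: "splits_UNIV m Agg" using assms(1) by (simp add: aggregates_def)
  have bd: "block_diagonal m Agg Q Pp" using assms(3) by (simp add: aggregate_complement_def)
  have "(\<lambda>j. column j (block Pp (Agg i) (Q i))) ` Q i = (\<lambda>j. column j Pp) ` Q i"
    by (intro image_cong refl block_diagonal_column(2)[OF bd split_Agg assms(4)])
  moreover have "span ((\<lambda>j. column j (block Pp (Agg i) (Q i))) ` Q i) =
      {x \<in> vecs_on (Agg i). \<forall>y \<in> range ((*v) (block P (Agg i) (C i))).
        x \<bullet> (block D (Agg i) (Agg i) *v y) = 0}"
    using assms(3,4) unfolding aggregate_complement_def Let_def by blast
  ultimately show ?thesis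
    using orthogonal_to_block_range_iff[OF assms(2) split_Agg assms(4)] by (simp cong: conj_cong)
qed

text \<open>The inclusion from right to left cuts a vector into its restrictions to the aggregates.
  Each of them stays \<open>D\<close>-orthogonal to the columns of \<open>P\<close> on its aggregate, because the part
  that is cut off has support disjoint from these columns.\<close>

lemma range_aggregate_complement:
  fixes D :: "real^'n^'n" and P :: "real^'c^'n" and Pp :: "real^'p^'n"
  assumes "diagonal_matrix D" and "aggregates m Agg" and "block_diagonal m Agg C P"
    and "aggregate_complement m Agg C Q D P Pp"
  shows "range ((*v) Pp) = {x. \<forall>y. x \<bullet> (D *v (P *v y)) = 0}"
proof -
  have split_Agg: "splits_UNIV m Agg" using assms(2) by (simp add: aggregates_def)
  have bd: "block_diagonal m Agg Q Pp" using assms(4) by (simp add: aggregate_complement_def)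
  then have split_Q: "splits_UNIV m Q" by (simp add: block_diagonal_def)
  have split_C: "splits_UNIV m C" using assms(3) by (simp add: block_diagonal_def)
  have range_span: "range ((*v) Pp) = span (range (\<lambda>j. column j Pp))"
  proof
    show "range ((*v) Pp) \<subseteq> span (range (\<lambda>j. column j Pp))"
      by (auto simp: matrix_mult_sum[of Pp] scalar_mult_eq_scaleR
          intro!: span_sum intro: span_scale span_base)
    have "range (\<lambda>j. column j Pp) \<subseteq> range ((*v) Pp)"
      by (auto simp: matrix_vector_mult_basis[symmetric])
    then show "span (range (\<lambda>j. column j Pp)) \<subseteq> range ((*v) Pp)"
      by (intro span_minimal linear_subspace_image matrix_vector_mul_linear subspace_UNIV)
  qed
  let ?N = "{x. \<forall>l. x \<bullet> (D *v column l P) = 0}"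
  have "column j Pp \<bullet> (D *v column l P) = 0" for j l
  proof -
    obtain i where i: "i \<in> {1..m}" "j \<in> Q i" by (rule splits_UNIV_cases[OF split_Q])
    obtain i' where i': "i' \<in> {1..m}" "l \<in> C i'" by (rule splits_UNIV_cases[OF split_C])
    show ?thesis
    proof (cases "i = i'")
      case True
      have "column j Pp \<in> span ((\<lambda>j. column j Pp) ` Q i)"
        using i by (simp add: span_base)
      then show ?thesis
        using True i' aggregate_complement_span[OF assms(2-4) i(1)] by simp
    next
      case False
      show ?thesis
        using inner_diagonal_disjoint[OF assms(1) block_diagonal_column(1)[OF bd split_Agg i]
            block_diagonal_column(1)[OF assms(3) split_Agg i']]
          splits_UNIV_disjoint[OF split_Agg i(1) i'(1) False] by simp
    qed
  qed
  moreover have "subspace ?N"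
    by (auto simp: subspace_def inner_add_left)
  ultimately have "span (range (\<lambda>j. column j Pp)) \<subseteq> ?N"
    by (intro span_minimal) auto
  moreover have "x \<in> span (range (\<lambda>j. column j Pp))" if x: "x \<in> ?N" for x
  proof -
    define r :: "nat \<Rightarrow> real^'n" where "r i = (\<chi> k. if k \<in> Agg i then x $ k else 0)" for i
    have "r i \<in> span (range (\<lambda>j. column j Pp))" if i: "i \<in> {1..m}" for i
    proof -
      have "r i \<bullet> (D *v column l P) = 0" if l: "l \<in> C i" for l
      proof -
        have "x - r i \<in> vecs_on (- Agg i)" by (simp add: r_def vecs_on_def)
        then have "(x - r i) \<bullet> (D *v column l P) = 0"
          using inner_diagonal_disjoint[OF assms(1) _ block_diagonal_column(1)[where i = i]]
            assms(3) split_Agg i l by blast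
        then show ?thesis using x by (simp add: inner_diff_left)
      qed
      moreover have "r i \<in> vecs_on (Agg i)" by (simp add: r_def vecs_on_def)
      ultimately have "r i \<in> span ((\<lambda>j. column j Pp) ` Q i)"
        using aggregate_complement_span[OF assms(2-4) i] by simp
      then show ?thesis
        using span_mono[of "(\<lambda>j. column j Pp) ` Q i" "range (\<lambda>j. column j Pp)"] by blast
    qed
    then have "(\<Sum>i\<in>{1..m}. r i) \<in> span (range (\<lambda>j. column j Pp))"
      by (rule span_sum)
    moreover have "x = (\<Sum>i\<in>{1..m}. r i)"
    proof -
      have "(\<Sum>i\<in>{1..m}. r i) $ k = x $ k" for k
      proof -
        obtain i where i: "i \<in> {1..m}" "k \<in> Agg i" by (rule splits_UNIV_cases[OF split_Agg])
        have "(\<Sum>i'\<in>{1..m}. r i' $ k) = (\<Sum>i'\<in>{1..m}. if i' = i then x $ k else 0)"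
          using splits_UNIV_disjoint[OF split_Agg i(1)] i(2)
          by (intro sum.cong) (auto simp: r_def)
        then show ?thesis using i(1) by simp
      qed
      then show ?thesis by (simp add: vec_eq_iff)
    qed
    ultimately show ?thesis by simp
  qed
  ultimately show ?thesis
    using range_span by (auto simp: orthogonal_to_range_iff)
qed

section \<open>The decomposition\<close>

theorem theorem3p2:
  fixes A D :: "real^'n^'n"
    and P :: "real^'c^'n"
    and Pp :: "real^'p^'n"
    and n_a :: nat
    and Agg :: "nat \<Rightarrow> 'n set"
    and C :: "nat \<Rightarrow> 'c set"
    and Q :: "nat \<Rightarrow> 'p set"
  assumes "spd A"
    and "spd D" and "diagonal_matrix D"
    and "\<forall>v. v \<bullet> (A *v v) \<le> v \<bullet> (D *v v)"
    and "aggregates n_a Agg"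
    and "1 \<le> CARD('c)" and "CARD('c) < CARD('n)"
    and "CARD('p) = CARD('n) - CARD('c)"
    and "rank P = CARD('c)"
    and "block_diagonal n_a Agg C P"
    and "aggregate_complement n_a Agg C Q D P Pp"
  shows "\<forall>u. \<exists>v.
      u = (mat 1 - pi_D D P) *v v + (mat 1 - pi_f A Pp) *v (pi_D D P *v u) \<and>
      ((mat 1 - pi_D D P) *v v) \<bullet> (A *v ((mat 1 - pi_f A Pp) *v (pi_D D P *v u))) = 0"
proof
  fix u
  have inj_P: "inj ((*v) P)"
    using assms(9) by (simp add: full_rank_injective)
  have inj_Pp: "inj ((*v) Pp)"
    using aggregate_complement_orthonormal[OF assms(3,5,11)]
    by (rule inj_if_orthonormal_columns)
  have range_Pp: "range ((*v) Pp) = {x. \<forall>y. x \<bullet> (D *v (P *v y)) = 0}"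
    by (rule range_aggregate_complement[OF assms(3,5,10,11)])
  define w where "w = pi_D D P *v u"
  define q where "q = pi_f A Pp *v w"
  have kernel: "pi_D D P *v q = 0"
  proof (rule projector_kernel)
    have "q \<in> range ((*v) Pp)"
      unfolding q_def pi_f_eq_pi_D by (rule projector_in_range)
    then show "q \<bullet> (D *v (P *v y)) = 0" for y
      using range_Pp by blast
  qed (use assms(2) in \<open>simp add: spd_def\<close>)
  define v where "v = u + q"
  have fine: "(mat 1 - pi_D D P) *v v = u - w + q"
    unfolding v_def using kernel
    by (simp add: w_def matrix_vector_mult_diff_rdistrib matrix_vector_right_distrib)
  have coarse: "(mat 1 - pi_f A Pp) *v w = w - q"
    by (simp add: q_def matrix_vector_mult_diff_rdistrib)
  have "(mat 1 - pi_D D P) *v v \<in> range ((*v) Pp)"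
    unfolding range_Pp using projector_residual_orthogonal[OF assms(2) inj_P, of _ v]
      spd_inner_commute[OF assms(2)]
    by (simp add: matrix_vector_mult_diff_rdistrib)
  then obtain z where z: "(mat 1 - pi_D D P) *v v = Pp *v z"
    by blast
  have "(Pp *v z) \<bullet> (A *v (w - q)) = 0"
    unfolding q_def pi_f_eq_pi_D by (rule projector_residual_orthogonal[OF assms(1) inj_Pp])
  moreover have "u = (mat 1 - pi_D D P) *v v + (mat 1 - pi_f A Pp) *v w"
    by (simp only: fine coarse) simp
  ultimately show "\<exists>v. u = (mat 1 - pi_D D P) *v v + (mat 1 - pi_f A Pp) *v (pi_D D P *v u) \<and>
      ((mat 1 - pi_D D P) *v v) \<bullet> (A *v ((mat 1 - pi_f A Pp) *v (pi_D D P *v u))) = 0"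
    using z coarse unfolding w_def by metis
qed

end
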